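(* Let $\mathfrak{g}$ be a solvable complex Lie algebra of dimension 3 and $\theta$ a cyclic 2-cocycle of $\mathfrak{g}$. If the $T^*$-extension $T^*_\theta(\mathfrak{g})$ of $\mathfrak{g}$ by means of $\theta$ is indecomposable (as a quadratic Lie algebra), then it is i-isomorphic to one of the following 6-dimensional quadratic Lie algebras with basis $\{X,Y,Z,X^*,Y^*,Z^*\}$, whose invariant bilinear form is given by $B(X,X^* )=B(Y,Y^* )=B(Z,Z^* )=1$ and zero on all other pairs of basis vectors, and whose nonzero brackets (up to skew-symmetry) are: (1) $\mathfrak{g}_{6,1}$: $[X,Y]=Z$, $[X,Z^*]=-Y^*$, $[Y,Z^*]=X^*$; (2) $\mathfrak{g}_{6,2}$: $[X,Y]=Y$, $[X,Z]=Y+Z$, $[X,Y^*]=-Y^*-Z^*$, $[X,Z^*]=-Z^*$, $[Y,Y^*]=[Z,Y^*]=[Z,Z^*]=X^*$; (3) $\mathfrak{g}_{6,3}$: $[X,Y]=Y$, $[X,Z]=\mu Z$, $[X,Y^*]=-Y^*$, $[X,Z^*]=-\mu Z^*$, $[Y,Y^*]=X^*$, $[Z,Z^*]=\mu X^*$, for some $\mu\in\mathbb{C}$ with $|\mu|\le 1$, $\mu\neq-1$.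
   Context: All vector spaces are finite-dimensional over $\mathbb{C}$. A quadratic Lie algebra $(\mathfrak{g},B)$ is a Lie algebra with a non-degenerate symmetric bilinear form $B$ that is invariant: $B([X,Y],Z)=B(X,[Y,Z])$. It is indecomposable if $\mathfrak{g}=\mathfrak{g}_1\oplus\mathfrak{g}_2$ with $\mathfrak{g}_1,\mathfrak{g}_2$ $B$-orthogonal ideals implies $\mathfrak{g}_1=\{0\}$ or $\mathfrak{g}_2=\{0\}$. An i-isomorphism of quadratic Lie algebras is a Lie algebra isomorphism preserving the bilinear forms. A 2-cocycle of a Lie algebra $\mathfrak{g}$ is a skew-symmetric bilinear map $\theta:\mathfrak{g}\times\mathfrak{g}\to\mathfrak{g}^*$ such that the sum over cyclic permutations of $(X,Y,Z)$ of $\theta(X,Y)\circ\mathrm{ad}(Z)+\theta([X,Y],Z)$ vanishes for all $X,Y,Z$; it is cyclic if $\theta(X,Y)Z=\theta(Y,Z)X$ for all $X,Y,Z$. For a cyclic 2-cocycle $\theta$, the $T^*$-extension $T^*_\theta(\mathfrak{g})$ is the quadratic Lie algebra $\mathfrak{g}\oplus\mathfrak{g}^*$ with bracket $[X+f,Y+g]=[X,Y]+\mathrm{ad}^*(X)(g)-\mathrm{ad}^*(Y)(f)+\theta(X,Y)$, where $\mathrm{ad}^*(X)(f)=-f\circ\mathrm{ad}(X)$, and bilinear form $B(X+f,Y+g)=f(Y)+g(X)$. *)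

theory Defs
  imports "HOL-Analysis.Analysis" "HOL-Library.Function_Algebras"
begin

text \<open>
  The underlying space of a Lie algebra is a subspace \<open>carr G\<close> of an ambient complex vector space:
  a type \<open>'a\<close> of class \<^class>\<open>ab_group_add\<close> with scalar multiplication \<open>scal G\<close>. The values of
  \<open>brack G\<close> (and below of \<open>form G\<close>) outside the carrier are irrelevant. Carriers are needed because
  the dual of a space is a proper subset of a function type.
\<close>

record 'a lie_alg =
  scal :: "complex \<Rightarrow> 'a \<Rightarrow> 'a"
  carr :: "'a set"
  brack :: "'a \<Rightarrow> 'a \<Rightarrow> 'a"

record 'a quad_lie_alg = "'a lie_alg" +
  form :: "'a \<Rightarrow> 'a \<Rightarrow> complex"

definition linear_on ::
  "'a::ab_group_add set \<Rightarrow> (complex \<Rightarrow> 'a \<Rightarrow> 'a) \<Rightarrow> (complex \<Rightarrow> 'b::ab_group_add \<Rightarrow> 'b) \<Rightarrow> ('a \<Rightarrow> 'b) \<Rightarrow> bool"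
  where
  "linear_on V s t f \<longleftrightarrow>
     (\<forall>x\<in>V. \<forall>y\<in>V. f (x + y) = f x + f y) \<and> (\<forall>c. \<forall>x\<in>V. f (s c x) = t c (f x))"

definition bilinear_on ::
  "'a::ab_group_add set \<Rightarrow> (complex \<Rightarrow> 'a \<Rightarrow> 'a) \<Rightarrow> (complex \<Rightarrow> 'b::ab_group_add \<Rightarrow> 'b) \<Rightarrow> ('a \<Rightarrow> 'a \<Rightarrow> 'b) \<Rightarrow> bool"
  where
  "bilinear_on V s t f \<longleftrightarrow>
     (\<forall>x\<in>V. linear_on V s t (f x)) \<and> (\<forall>y\<in>V. linear_on V s t (\<lambda>x. f x y))"

locale lie_algebra = vector_space "scal G"
  for G :: "('a::ab_group_add, 'm) lie_alg_scheme" +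
  assumes subspace_carr: "subspace (carr G)"
    and finite_dim: "\<exists>S. finite S \<and> span S = carr G"
    and brack_closed: "x \<in> carr G \<Longrightarrow> y \<in> carr G \<Longrightarrow> brack G x y \<in> carr G"
    and brack_bilinear: "bilinear_on (carr G) (scal G) (scal G) (brack G)"
    and brack_self: "x \<in> carr G \<Longrightarrow> brack G x x = 0"
    and jacobi: "x \<in> carr G \<Longrightarrow> y \<in> carr G \<Longrightarrow> z \<in> carr G \<Longrightarrow>
      brack G x (brack G y z) + brack G y (brack G z x) + brack G z (brack G x y) = 0"

primrec derived_series :: "('a::ab_group_add, 'm) lie_alg_scheme \<Rightarrow> nat \<Rightarrow> 'a set" where
  "derived_series G 0 = carr G"
| "derived_series G (Suc n) =
     module.span (scal G) {brack G x y |x y. x \<in> derived_series G n \<and> y \<in> derived_series G n}"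

definition lie_solvable :: "('a::ab_group_add, 'm) lie_alg_scheme \<Rightarrow> bool" where
  "lie_solvable G \<longleftrightarrow> (\<exists>n. derived_series G n = {0})"

definition lie_ideal :: "('a::ab_group_add, 'm) lie_alg_scheme \<Rightarrow> 'a set \<Rightarrow> bool" where
  "lie_ideal G I \<longleftrightarrow>
     module.subspace (scal G) I \<and> I \<subseteq> carr G \<and> (\<forall>x\<in>carr G. \<forall>y\<in>I. brack G x y \<in> I)"

locale quadratic_lie_algebra = lie_algebra G
  for G :: "('a::ab_group_add, 'm) quad_lie_alg_scheme" +
  assumes form_bilinear: "bilinear_on (carr G) (scal G) (*) (form G)"
    and form_sym: "x \<in> carr G \<Longrightarrow> y \<in> carr G \<Longrightarrow> form G x y = form G y x"
    and form_nondegenerate: "x \<in> carr G \<Longrightarrow> (\<And>y. y \<in> carr G \<Longrightarrow> form G x y = 0) \<Longrightarrow> x = 0"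
    and form_invariant: "x \<in> carr G \<Longrightarrow> y \<in> carr G \<Longrightarrow> z \<in> carr G \<Longrightarrow>
      form G (brack G x y) z = form G x (brack G y z)"

definition indecomposable :: "('a::ab_group_add, 'm) quad_lie_alg_scheme \<Rightarrow> bool" where
  "indecomposable G \<longleftrightarrow>
     (\<forall>I J. lie_ideal G I \<longrightarrow> lie_ideal G J \<longrightarrow>
        {x + y |x y. x \<in> I \<and> y \<in> J} = carr G \<longrightarrow> I \<inter> J = {0} \<longrightarrow>
        (\<forall>x\<in>I. \<forall>y\<in>J. form G x y = 0) \<longrightarrow>
        I = {0} \<or> J = {0})"

definition i_isomorphic ::
  "('a::ab_group_add, 'm) quad_lie_alg_scheme \<Rightarrow> ('b::ab_group_add, 'n) quad_lie_alg_scheme \<Rightarrow> bool"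
  where
  "i_isomorphic G H \<longleftrightarrow>
     (\<exists>\<phi>. bij_betw \<phi> (carr G) (carr H) \<and> linear_on (carr G) (scal G) (scal H) \<phi> \<and>
        (\<forall>x\<in>carr G. \<forall>y\<in>carr G. \<phi> (brack G x y) = brack H (\<phi> x) (\<phi> y)) \<and>
        (\<forall>x\<in>carr G. \<forall>y\<in>carr G. form H (\<phi> x) (\<phi> y) = form G x y))"

text \<open>
  A linear form on \<open>carr G\<close> is represented by the function on \<open>'a\<close> that extends it by 0 outside
  \<open>carr G\<close>, so that the representation is unique.
\<close>

definition dual :: "('a::ab_group_add, 'm) lie_alg_scheme \<Rightarrow> ('a \<Rightarrow> complex) set" where
  "dual G = {f. linear_on (carr G) (scal G) (*) f \<and> (\<forall>x. x \<notin> carr G \<longrightarrow> f x = 0)}"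

definition dual_smult :: "complex \<Rightarrow> ('a \<Rightarrow> complex) \<Rightarrow> 'a \<Rightarrow> complex" where
  "dual_smult c f = (\<lambda>x. c * f x)"

definition coad :: "('a::ab_group_add, 'm) lie_alg_scheme \<Rightarrow> 'a \<Rightarrow> ('a \<Rightarrow> complex) \<Rightarrow> 'a \<Rightarrow> complex" where
  "coad G x f = (\<lambda>y. if y \<in> carr G then - f (brack G x y) else 0)"

definition two_cocycle ::
  "('a::ab_group_add, 'm) lie_alg_scheme \<Rightarrow> ('a \<Rightarrow> 'a \<Rightarrow> 'a \<Rightarrow> complex) \<Rightarrow> bool" where
  "two_cocycle G \<theta> \<longleftrightarrow>
     (\<forall>x\<in>carr G. \<forall>y\<in>carr G. \<theta> x y \<in> dual G) \<and>
     bilinear_on (carr G) (scal G) dual_smult \<theta> \<and>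
     (\<forall>x\<in>carr G. \<forall>y\<in>carr G. \<theta> x y = - \<theta> y x) \<and>
     (\<forall>x\<in>carr G. \<forall>y\<in>carr G. \<forall>z\<in>carr G. \<forall>w\<in>carr G.
        (\<theta> x y (brack G z w) + \<theta> (brack G x y) z w) +
        (\<theta> y z (brack G x w) + \<theta> (brack G y z) x w) +
        (\<theta> z x (brack G y w) + \<theta> (brack G z x) y w) = 0)"

definition cyclic_two_cocycle ::
  "('a::ab_group_add, 'm) lie_alg_scheme \<Rightarrow> ('a \<Rightarrow> 'a \<Rightarrow> 'a \<Rightarrow> complex) \<Rightarrow> bool" where
  "cyclic_two_cocycle G \<theta> \<longleftrightarrow> two_cocycle G \<theta> \<and>
     (\<forall>x\<in>carr G. \<forall>y\<in>carr G. \<forall>z\<in>carr G. \<theta> x y z = \<theta> y z x)"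

definition T_star ::
  "('a::ab_group_add, 'm) lie_alg_scheme \<Rightarrow> ('a \<Rightarrow> 'a \<Rightarrow> 'a \<Rightarrow> complex) \<Rightarrow>
   ('a \<times> ('a \<Rightarrow> complex)) quad_lie_alg" where
  "T_star G \<theta> =
     \<lparr>scal = (\<lambda>c (x, f). (scal G c x, dual_smult c f)),
      carr = carr G \<times> dual G,
      brack = (\<lambda>(x, f) (y, g). (brack G x y, coad G x g - coad G y f + \<theta> x y)),
      form = (\<lambda>(x, f) (y, g). f y + g x)\<rparr>"

text \<open>The index of a basis vector; \<open>bXs\<close>, \<open>bYs\<close>, \<open>bZs\<close> stand for \<open>X\<^sup>*\<close>, \<open>Y\<^sup>*\<close>, \<open>Z\<^sup>*\<close>.\<close>

datatype basis6 = bX | bY | bZ | bXs | bYs | bZs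

lemma UNIV_basis6: "UNIV = {bX, bY, bZ, bXs, bYs, bZs}"
  using basis6.exhaust by auto

instance basis6 :: finite
  by standard (simp add: UNIV_basis6)

abbreviation bvec :: "basis6 \<Rightarrow> complex ^ basis6" where
  "bvec i \<equiv> axis i 1"

text \<open>
  A table \<open>t\<close> lists brackets of basis vectors up to skew-symmetry: the bracket of the basis vectors
  \<open>i\<close> and \<open>j\<close> is \<open>t i j - t j i\<close>, and a table never lists both \<open>(i, j)\<close> and \<open>(j, i)\<close>.
\<close>

definition model6 :: "(basis6 \<Rightarrow> basis6 \<Rightarrow> complex ^ basis6) \<Rightarrow> (complex ^ basis6) quad_lie_alg" where
  "model6 t =
     \<lparr>scal = (*s),
      carr = UNIV,
      brack = (\<lambda>v w. \<Sum>i\<in>UNIV. \<Sum>j\<in>UNIV. (v $ i * w $ j) *s (t i j - t j i)),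
      form = (\<lambda>v w. v $ bX * w $ bXs + v $ bXs * w $ bX
                  + v $ bY * w $ bYs + v $ bYs * w $ bY
                  + v $ bZ * w $ bZs + v $ bZs * w $ bZ)\<rparr>"

fun table61 :: "basis6 \<Rightarrow> basis6 \<Rightarrow> complex ^ basis6" where
  "table61 bX bY = bvec bZ"
| "table61 bX bZs = - bvec bYs"
| "table61 bY bZs = bvec bXs"
| "table61 _ _ = 0"

fun table62 :: "basis6 \<Rightarrow> basis6 \<Rightarrow> complex ^ basis6" where
  "table62 bX bY = bvec bY"
| "table62 bX bZ = bvec bY + bvec bZ"
| "table62 bX bYs = - bvec bYs - bvec bZs"
| "table62 bX bZs = - bvec bZs"
| "table62 bY bYs = bvec bXs"
| "table62 bZ bYs = bvec bXs"
| "table62 bZ bZs = bvec bXs"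
| "table62 _ _ = 0"

fun table63 :: "complex \<Rightarrow> basis6 \<Rightarrow> basis6 \<Rightarrow> complex ^ basis6" where
  "table63 \<mu> bX bY = bvec bY"
| "table63 \<mu> bX bZ = \<mu> *s bvec bZ"
| "table63 \<mu> bX bYs = - bvec bYs"
| "table63 \<mu> bX bZs = - (\<mu> *s bvec bZs)"
| "table63 \<mu> bY bYs = bvec bXs"
| "table63 \<mu> bZ bZs = \<mu> *s bvec bXs"
| "table63 \<mu> _ _ = 0"

definition g61 :: "(complex ^ basis6) quad_lie_alg" where
  "g61 = model6 table61"

definition g62 :: "(complex ^ basis6) quad_lie_alg" where
  "g62 = model6 table62"

definition g63 :: "complex \<Rightarrow> (complex ^ basis6) quad_lie_alg" where
  "g63 \<mu> = model6 (table63 \<mu>)"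

end

theory Submission
  imports Defs
begin

text \<open>
  A solvable three-dimensional Lie algebra has an abelian ideal of codimension 1, so it is
  \<open>\<complex>X \<ltimes>\<^sub>A \<complex>\<^sup>2\<close>. Up to rescaling \<open>X\<close>, the Jordan form of \<open>A\<close> is \<open>0\<close>, a nilpotent block, the unipotent
  block, or \<open>diag(1, \<mu>)\<close> with \<open>|\<mu>| \<le> 1\<close>. A cyclic cocycle is an alternating 3-form, hence a single
  number \<open>t\<close>, and \<open>t\<close> is removed by a change of the complement of \<open>g\<^sup>*\<close> as soon as \<open>tr A \<noteq> 0\<close>.
  If \<open>A = 0\<close>, then \<open>t \<noteq> 0\<close> gives \<open>g\<^sub>6\<^sub>,\<^sub>1\<close> and \<open>t = 0\<close> is decomposable; for nilpotent \<open>A \<noteq> 0\<close> it is the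
  other way round. If \<open>A = diag(1, -1)\<close>, then \<open>t = 0\<close> gives \<open>g\<^sub>6\<^sub>,\<^sub>3(1)\<close> after exchanging \<open>Z\<close> and \<open>Z\<^sup>*\<close>,
  and \<open>t \<noteq> 0\<close> gives \<open>g\<^sub>6\<^sub>,\<^sub>2\<close>.
\<close>

section \<open>The model algebras and their coordinates\<close>

text \<open>
  The \<open>T\<^sup>*\<close>-extension of the Lie algebra \<open>[X, Y] = aY + bZ\<close>, \<open>[X, Z] = cY + dZ\<close>, \<open>[Y, Z] = 0\<close> by the cyclic
  cocycle with \<open>\<theta>(X, Y)Z = t\<close>.
\<close>

fun ext_table :: "complex \<Rightarrow> complex \<Rightarrow> complex \<Rightarrow> complex \<Rightarrow> complex \<Rightarrow> basis6 \<Rightarrow> basis6 \<Rightarrow> complex ^ basis6"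
  where
  "ext_table a b c d t bX bY = a *s bvec bY + b *s bvec bZ + t *s bvec bZs"
| "ext_table a b c d t bX bZ = c *s bvec bY + d *s bvec bZ - t *s bvec bYs"
| "ext_table a b c d t bY bZ = t *s bvec bXs"
| "ext_table a b c d t bX bYs = - (a *s bvec bYs) - c *s bvec bZs"
| "ext_table a b c d t bX bZs = - (b *s bvec bYs) - d *s bvec bZs"
| "ext_table a b c d t bY bYs = a *s bvec bXs"
| "ext_table a b c d t bY bZs = b *s bvec bXs"
| "ext_table a b c d t bZ bYs = c *s bvec bXs"
| "ext_table a b c d t bZ bZs = d *s bvec bXs"
| "ext_table a b c d t _ _ = 0"

definition ext_model where "ext_model a b c d t = model6 (ext_table a b c d t)"

lemma forall_basis6: "(\<forall>i. P i) \<longleftrightarrow> P bX \<and> P bY \<and> P bZ \<and> P bXs \<and> P bYs \<and> P bZs"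
  by (metis basis6.exhaust)

lemma model6_eqI: "\<forall>i j. s i j = t i j \<Longrightarrow> model6 s = model6 t"
  by (simp add: model6_def)

text \<open>All three target algebras are themselves extensions by the zero cocycle, this one of the
  Heisenberg algebra. So only isomorphisms inside one family of models have to be found.\<close>

lemma g61_eq: "g61 = ext_model 0 1 0 0 0"
  unfolding g61_def ext_model_def
  by (rule model6_eqI) (simp add: forall_basis6)

lemma g62_eq: "g62 = ext_model 1 0 1 1 0"
  unfolding g62_def ext_model_def
  by (rule model6_eqI) (simp add: forall_basis6)

lemma g63_eq: "g63 \<mu> = ext_model 1 0 0 \<mu> 0"
  unfolding g63_def ext_model_def
  by (rule model6_eqI) (simp add: forall_basis6)

lemma ext_model_simps [simp]:
  "carr (ext_model a b c d t) = UNIV"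
  "scal (ext_model a b c d t) = (*s)"
  "form (ext_model a b c d t) v w =
     v $ bX * w $ bXs + v $ bXs * w $ bX + v $ bY * w $ bYs + v $ bYs * w $ bY
     + v $ bZ * w $ bZs + v $ bZs * w $ bZ"
  by (simp_all add: ext_model_def model6_def)

lemma sum_basis6: "(\<Sum>i\<in>UNIV. f i) = f bX + f bY + f bZ + f bXs + f bYs + f bZs"
  by (simp add: UNIV_basis6 add.assoc)

text \<open>With the bracket known coordinate by coordinate, testing a linear map between two models
  becomes a comparison of polynomials in the coordinates.\<close>

lemma brack_ext_model [simp]:
  "brack (ext_model a b c d t) v w $ bX = 0"
  "brack (ext_model a b c d t) v w $ bY =
     a * (v $ bX * w $ bY - v $ bY * w $ bX) + c * (v $ bX * w $ bZ - v $ bZ * w $ bX)"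
  "brack (ext_model a b c d t) v w $ bZ =
     b * (v $ bX * w $ bY - v $ bY * w $ bX) + d * (v $ bX * w $ bZ - v $ bZ * w $ bX)"
  "brack (ext_model a b c d t) v w $ bXs =
     t * (v $ bY * w $ bZ - v $ bZ * w $ bY)
     + a * (v $ bY * w $ bYs - v $ bYs * w $ bY) + b * (v $ bY * w $ bZs - v $ bZs * w $ bY)
     + c * (v $ bZ * w $ bYs - v $ bYs * w $ bZ) + d * (v $ bZ * w $ bZs - v $ bZs * w $ bZ)"
  "brack (ext_model a b c d t) v w $ bYs =
     - t * (v $ bX * w $ bZ - v $ bZ * w $ bX)
     - a * (v $ bX * w $ bYs - v $ bYs * w $ bX) - b * (v $ bX * w $ bZs - v $ bZs * w $ bX)"
  "brack (ext_model a b c d t) v w $ bZs =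
     t * (v $ bX * w $ bY - v $ bY * w $ bX)
     - c * (v $ bX * w $ bYs - v $ bYs * w $ bX) - d * (v $ bX * w $ bZs - v $ bZs * w $ bX)"
  unfolding ext_model_def model6_def
  by (simp_all add: sum_basis6 axis_def) (simp_all add: algebra_simps)

definition vec6 :: "complex \<Rightarrow> complex \<Rightarrow> complex \<Rightarrow> complex \<Rightarrow> complex \<Rightarrow> complex \<Rightarrow> complex ^ basis6"
  where "vec6 x y z x' y' z' =
    (\<chi> i. case i of bX \<Rightarrow> x | bY \<Rightarrow> y | bZ \<Rightarrow> z | bXs \<Rightarrow> x' | bYs \<Rightarrow> y' | bZs \<Rightarrow> z')"

lemma vec6_nth [simp]:
  "vec6 x y z x' y' z' $ bX = x" "vec6 x y z x' y' z' $ bY = y" "vec6 x y z x' y' z' $ bZ = z"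
  "vec6 x y z x' y' z' $ bXs = x'" "vec6 x y z x' y' z' $ bYs = y'" "vec6 x y z x' y' z' $ bZs = z'"
  by (simp_all add: vec6_def)

section \<open>Isomorphisms between model algebras\<close>

lemma i_isomorphic_trans:
  assumes "i_isomorphic G H" "i_isomorphic H K"
  shows "i_isomorphic G K"
proof -
  obtain \<phi> where p: "bij_betw \<phi> (carr G) (carr H)" "linear_on (carr G) (scal G) (scal H) \<phi>"
    "\<forall>x\<in>carr G. \<forall>y\<in>carr G. \<phi> (brack G x y) = brack H (\<phi> x) (\<phi> y)"
    "\<forall>x\<in>carr G. \<forall>y\<in>carr G. form H (\<phi> x) (\<phi> y) = form G x y"
    using assms(1) unfolding i_isomorphic_def by blast
  obtain \<psi> where q: "bij_betw \<psi> (carr H) (carr K)" "linear_on (carr H) (scal H) (scal K) \<psi>"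
    "\<forall>x\<in>carr H. \<forall>y\<in>carr H. \<psi> (brack H x y) = brack K (\<psi> x) (\<psi> y)"
    "\<forall>x\<in>carr H. \<forall>y\<in>carr H. form K (\<psi> x) (\<psi> y) = form H x y"
    using assms(2) unfolding i_isomorphic_def by blast
  have in_H: "\<phi> x \<in> carr H" if "x \<in> carr G" for x
    using bij_betw_apply[OF p(1) that] .
  show ?thesis
    unfolding i_isomorphic_def
  proof (intro exI[of _ "\<psi> \<circ> \<phi>"] conjI)
    show "bij_betw (\<psi> \<circ> \<phi>) (carr G) (carr K)"
      using p(1) q(1) by (rule bij_betw_trans)
    show "linear_on (carr G) (scal G) (scal K) (\<psi> \<circ> \<phi>)"
      using p(2) q(2) in_H by (simp add: linear_on_def)
    show "\<forall>x\<in>carr G. \<forall>y\<in>carr G. (\<psi> \<circ> \<phi>) (brack G x y) = brack K ((\<psi> \<circ> \<phi>) x) ((\<psi> \<circ> \<phi>) y)"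
      using p(3) q(3) in_H by simp
    show "\<forall>x\<in>carr G. \<forall>y\<in>carr G. form K ((\<psi> \<circ> \<phi>) x) ((\<psi> \<circ> \<phi>) y) = form G x y"
      using p(4) q(4) in_H by simp
  qed
qed

lemma ext_model_isoI:
  assumes "\<And>v. \<psi> (\<phi> v) = v" "\<And>v. \<phi> (\<psi> v) = v"
    and "\<And>v w. \<phi> (v + w) = \<phi> v + \<phi> w" "\<And>c v. \<phi> (c *s v) = c *s \<phi> v"
    and "\<And>v w. \<phi> (brack (ext_model a b c d t) v w) = brack (ext_model a' b' c' d' t') (\<phi> v) (\<phi> w)"
    and "\<And>v w. form (ext_model a' b' c' d' t') (\<phi> v) (\<phi> w) = form (ext_model a b c d t) v w"
  shows "i_isomorphic (ext_model a b c d t) (ext_model a' b' c' d' t')"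
  unfolding i_isomorphic_def
proof (intro exI[of _ \<phi>] conjI)
  show "bij_betw \<phi> (carr (ext_model a b c d t)) (carr (ext_model a' b' c' d' t'))"
    by (rule bij_betw_byWitness[where f' = \<psi>]) (use assms(1,2) in auto)
qed (use assms(3-6) in \<open>simp_all add: linear_on_def\<close>)

lemma ext_model_kill_cocycle:
  assumes "a + d \<noteq> 0"
  shows "i_isomorphic (ext_model a b c d t) (ext_model a b c d 0)"
proof -
  \<comment> \<open>The new basis vectors are \<open>Y + sZ\<^sup>*\<close> and \<open>Z - sY\<^sup>*\<close>, whose bracket is \<open>(t - s (a + d)) X\<^sup>*\<close>.\<close>
  define s where "s = t / (a + d)"
  have t: "t = s * (a + d)"
    using assms by (simp add: s_def)
  show ?thesis
    by (rule ext_model_isoI[where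
          \<phi> = "\<lambda>v. vec6 (v $ bX) (v $ bY) (v $ bZ) (v $ bXs) (v $ bYs + s * v $ bZ) (v $ bZs - s * v $ bY)" and
          \<psi> = "\<lambda>v. vec6 (v $ bX) (v $ bY) (v $ bZ) (v $ bXs) (v $ bYs - s * v $ bZ) (v $ bZs + s * v $ bY)"])
      (simp_all add: vec_eq_iff forall_basis6 t algebra_simps)
qed

text \<open>Only the cocycle contributes to the bracket, and [X, Y] = tZ^* takes the place of Z. The
  isotropic pair Z, Z^* is exchanged, with factors t and 1/t that preserve the form.\<close>

lemma ext_model_abelian_iso_g61:
  assumes "t \<noteq> 0"
  shows "i_isomorphic (ext_model 0 0 0 0 t) g61"
  unfolding g61_eq
  by (rule ext_model_isoI[where
        \<phi> = "\<lambda>v. vec6 (v $ bX) (v $ bY) (v $ bZs / t) (v $ bXs) (v $ bYs) (t * v $ bZ)" and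
        \<psi> = "\<lambda>v. vec6 (v $ bX) (v $ bY) (v $ bZs / t) (v $ bXs) (v $ bYs) (t * v $ bZ)"])
    (use assms in \<open>simp_all add: vec_eq_iff forall_basis6 field_simps\<close>)

text \<open>The eigenvalues of ad X on Z and Z^* are opposite, here -1 and 1, so exchanging the two
  vectors turns diag(1, -1) into the identity.\<close>

lemma ext_model_unimodular_iso_g63:
  "i_isomorphic (ext_model 1 0 0 (-1) 0) (g63 1)"
  unfolding g63_eq
  by (rule ext_model_isoI[where
        \<phi> = "\<lambda>v. vec6 (v $ bX) (v $ bY) (v $ bZs) (v $ bXs) (v $ bYs) (v $ bZ)" and
        \<psi> = "\<lambda>v. vec6 (v $ bX) (v $ bY) (v $ bZs) (v $ bXs) (v $ bYs) (v $ bZ)"])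
    (simp_all add: vec_eq_iff forall_basis6 algebra_simps)

text \<open>Here [X, Z^*] = Z^* and [X, Y] = Y + tZ^*, so ad X has a unipotent Jordan block on the
  isotropic plane with basis tZ^*, Y. These two vectors become the new Y and Z.\<close>

lemma ext_model_unimodular_iso_g62:
  assumes "t \<noteq> 0"
  shows "i_isomorphic (ext_model 1 0 0 (-1) t) g62"
  unfolding g62_eq
  by (rule ext_model_isoI[where
        \<phi> = "\<lambda>v. vec6 (v $ bX) (v $ bZs / t) (v $ bY) (v $ bXs) (t * v $ bZ) (v $ bYs)" and
        \<psi> = "\<lambda>v. vec6 (v $ bX) (v $ bZ) (v $ bYs / t) (v $ bXs) (v $ bZs) (t * v $ bY)"])
    (use assms in \<open>simp_all add: vec_eq_iff forall_basis6 field_simps\<close>)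

section \<open>Eigenvectors, brackets and bases\<close>

text \<open>The eigenvector is a row (p, q) because it lists the coefficients of pY + qZ, while (a,
  b) and (c, d) are the coordinates of [X, Y] and [X, Z]. If b is nonzero, the quadratic formula
  gives a root \<open>l\<close> of the characteristic polynomial, and (l - d, b) is an
  eigenvector.\<close>

lemma complex_matrix2_eigenvector:
  fixes a b c d :: complex
  obtains l p q where "p * a + q * c = l * p" "p * b + q * d = l * q" "p \<noteq> 0 \<or> q \<noteq> 0"
proof (cases "b = 0")
  case True
  then show ?thesis
    using that[of 1 0 a] by simp
next
  case False
  define l where "l = (a + d + csqrt ((a - d)\<^sup>2 + 4 * b * c)) / 2"
  have "(2 * l - (a + d))\<^sup>2 = (a - d)\<^sup>2 + 4 * b * c"
    by (simp add: l_def add_divide_distrib)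
  then have "(l - d) * a + b * c = l * (l - d)"
    by algebra
  then show ?thesis
    using that[of "l - d" b l] False by (simp add: algebra_simps)
qed

context lie_algebra
begin

abbreviation smul :: "complex \<Rightarrow> 'a \<Rightarrow> 'a" (infixr \<open>\<cdot>\<close> 75)
  where "c \<cdot> x \<equiv> scal G c x"

lemma carr_0: "0 \<in> carr G"
  using subspace_carr by (rule subspace_0)

lemma carr_add: "x \<in> carr G \<Longrightarrow> y \<in> carr G \<Longrightarrow> x + y \<in> carr G"
  using subspace_carr by (rule subspace_add)

lemma carr_scale: "x \<in> carr G \<Longrightarrow> c \<cdot> x \<in> carr G"
  using subspace_carr by (rule subspace_scale)

lemmas carr_closed = carr_0 carr_add carr_scale brack_closed

lemma brack_add_left:
  "x \<in> carr G \<Longrightarrow> y \<in> carr G \<Longrightarrow> z \<in> carr G \<Longrightarrow> brack G (x + y) z = brack G x z + brack G y z"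
  using brack_bilinear by (simp add: bilinear_on_def linear_on_def)

lemma brack_add_right:
  "x \<in> carr G \<Longrightarrow> y \<in> carr G \<Longrightarrow> z \<in> carr G \<Longrightarrow> brack G z (x + y) = brack G z x + brack G z y"
  using brack_bilinear by (simp add: bilinear_on_def linear_on_def)

lemma brack_scale_left:
  "x \<in> carr G \<Longrightarrow> z \<in> carr G \<Longrightarrow> brack G (c \<cdot> x) z = c \<cdot> brack G x z"
  using brack_bilinear by (simp add: bilinear_on_def linear_on_def)

lemma brack_scale_right:
  "x \<in> carr G \<Longrightarrow> z \<in> carr G \<Longrightarrow> brack G z (c \<cdot> x) = c \<cdot> brack G z x"
  using brack_bilinear by (simp add: bilinear_on_def linear_on_def)

lemma brack_skew:
  assumes "x \<in> carr G" "y \<in> carr G"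
  shows "brack G y x = - brack G x y"
proof -
  have "brack G (x + y) (x + y) = brack G x y + brack G y x"
    using assms by (simp add: brack_add_left brack_add_right carr_closed) (simp add: brack_self)
  then have "brack G x y + brack G y x = 0"
    using assms by (simp add: brack_self carr_closed)
  then show ?thesis
    by (simp add: eq_neg_iff_add_eq_0 add.commute)
qed

lemma lincomb_closed:
  "X \<in> carr G \<Longrightarrow> Y \<in> carr G \<Longrightarrow> Z \<in> carr G \<Longrightarrow> x \<cdot> X + y \<cdot> Y + z \<cdot> Z \<in> carr G"
  by (intro carr_closed)

lemma brack_lincomb:
  assumes "X \<in> carr G" "Y \<in> carr G" "Z \<in> carr G"
  shows "brack G (x \<cdot> X + y \<cdot> Y + z \<cdot> Z) (x' \<cdot> X + y' \<cdot> Y + z' \<cdot> Z) =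
    (x * y' - y * x') \<cdot> brack G X Y + (x * z' - z * x') \<cdot> brack G X Z + (y * z' - z * y') \<cdot> brack G Y Z"
  using assms
  by (simp add: brack_add_left brack_add_right brack_scale_left brack_scale_right carr_closed brack_self
      brack_skew[of X Y] brack_skew[of X Z] brack_skew[of Y Z] scale_left_diff_distrib scale_right_distrib
      algebra_simps)

text \<open>Independence is stated by coefficients of an ordered triple, which also rules out
  repeated vectors. That the triple spans follows in dimension 3, see
  \<open>frame_span\<close>.\<close>

definition frame :: "'a \<Rightarrow> 'a \<Rightarrow> 'a \<Rightarrow> bool"
  where "frame X Y Z \<longleftrightarrow> X \<in> carr G \<and> Y \<in> carr G \<and> Z \<in> carr G \<and>
    (\<forall>x y z. x \<cdot> X + y \<cdot> Y + z \<cdot> Z = 0 \<longrightarrow> x = 0 \<and> y = 0 \<and> z = 0)"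

lemma frame_eq_iff:
  assumes "frame X Y Z"
  shows "x \<cdot> X + y \<cdot> Y + z \<cdot> Z = x' \<cdot> X + y' \<cdot> Y + z' \<cdot> Z \<longleftrightarrow> x = x' \<and> y = y' \<and> z = z'"
proof
  assume *: "x \<cdot> X + y \<cdot> Y + z \<cdot> Z = x' \<cdot> X + y' \<cdot> Y + z' \<cdot> Z"
  have "(x - x') \<cdot> X + (y - y') \<cdot> Y + (z - z') \<cdot> Z =
      (x \<cdot> X + y \<cdot> Y + z \<cdot> Z) - (x' \<cdot> X + y' \<cdot> Y + z' \<cdot> Z)"
    by (simp add: scale_left_diff_distrib)
  then have "(x - x') \<cdot> X + (y - y') \<cdot> Y + (z - z') \<cdot> Z = 0"
    using * by simp
  then show "x = x' \<and> y = y' \<and> z = z'"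
    using assms unfolding frame_def by (metis eq_iff_diff_eq_0)
qed simp

lemma frame_iff_independent:
  "frame X Y Z \<longleftrightarrow>
    {X, Y, Z} \<subseteq> carr G \<and> independent {X, Y, Z} \<and> card {X, Y, Z} = 3"
proof
  assume F: "frame X Y Z"
  then have zero: "x = 0 \<and> y = 0 \<and> z = 0" if "x \<cdot> X + y \<cdot> Y + z \<cdot> Z = 0" for x y z
    using that unfolding frame_def by blast
  have ne: "X \<noteq> Y" "X \<noteq> Z" "Y \<noteq> Z"
    using zero[of 1 "-1" 0] zero[of 1 0 "-1"] zero[of 0 1 "-1"] by auto
  have "independent {X, Y, Z}"
    using zero ne by (auto simp: dependent_finite add.assoc)
  then show "{X, Y, Z} \<subseteq> carr G \<and> independent {X, Y, Z} \<and> card {X, Y, Z} = 3"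
    using F ne by (simp add: frame_def)
next
  assume B: "{X, Y, Z} \<subseteq> carr G \<and> independent {X, Y, Z} \<and> card {X, Y, Z} = 3"
  then have ne: "X \<noteq> Y" "X \<noteq> Z" "Y \<noteq> Z"
    by (auto simp: card_insert_if split: if_splits)
  have "x = 0 \<and> y = 0 \<and> z = 0" if "x \<cdot> X + y \<cdot> Y + z \<cdot> Z = 0" for x y z
  proof -
    define u where "u v = (if v = X then x else if v = Y then y else z)" for v
    have "(\<Sum>v\<in>{X, Y, Z}. u v \<cdot> v) = 0"
      using that ne by (simp add: u_def add.assoc)
    then have "u v = 0" if "v \<in> {X, Y, Z}" for v
      using B that by (intro independentD[of "{X, Y, Z}" "{X, Y, Z}"]) auto
    from this[of X] this[of Y] this[of Z] show ?thesis
      using ne by (simp add: u_def)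
  qed
  then show "frame X Y Z"
    using B by (simp add: frame_def)
qed

lemma frame_change:
  assumes "frame X Y Z"
    and X': "X' = x1 \<cdot> X + y1 \<cdot> Y + z1 \<cdot> Z"
    and Y': "Y' = x2 \<cdot> X + y2 \<cdot> Y + z2 \<cdot> Z"
    and Z': "Z' = x3 \<cdot> X + y3 \<cdot> Y + z3 \<cdot> Z"
    and det: "x1 * (y2 * z3 - y3 * z2) - x2 * (y1 * z3 - y3 * z1) + x3 * (y1 * z2 - y2 * z1) \<noteq> 0"
  shows "frame X' Y' Z'"
proof -
  have carr: "X \<in> carr G" "Y \<in> carr G" "Z \<in> carr G"
    using assms(1) by (simp_all add: frame_def)
  have "u = 0 \<and> v = 0 \<and> w = 0" if *: "u \<cdot> X' + v \<cdot> Y' + w \<cdot> Z' = 0" for u v w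
  proof -
    have "u \<cdot> X' + v \<cdot> Y' + w \<cdot> Z' =
        (u * x1 + v * x2 + w * x3) \<cdot> X + (u * y1 + v * y2 + w * y3) \<cdot> Y + (u * z1 + v * z2 + w * z3) \<cdot> Z"
      by (simp add: X' Y' Z' scale_right_distrib scale_left_distrib algebra_simps)
    then have e: "u * x1 + v * x2 + w * x3 = 0" "u * y1 + v * y2 + w * y3 = 0" "u * z1 + v * z2 + w * z3 = 0"
      using assms(1) * unfolding frame_def by metis+
    let ?D = "x1 * (y2 * z3 - y3 * z2) - x2 * (y1 * z3 - y3 * z1) + x3 * (y1 * z2 - y2 * z1)"
    let ?e1 = "u * x1 + v * x2 + w * x3" and ?e2 = "u * y1 + v * y2 + w * y3"
      and ?e3 = "u * z1 + v * z2 + w * z3"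
    \<comment> \<open>Cramer's rule: the cofactors of the coefficient matrix isolate one unknown at
      a time.\<close>
    have "?D * u = (y2 * z3 - y3 * z2) * ?e1 - (x2 * z3 - x3 * z2) * ?e2 + (x2 * y3 - x3 * y2) * ?e3"
      "?D * v = - (y1 * z3 - y3 * z1) * ?e1 + (x1 * z3 - x3 * z1) * ?e2 - (x1 * y3 - x3 * y1) * ?e3"
      "?D * w = (y1 * z2 - y2 * z1) * ?e1 - (x1 * z2 - x2 * z1) * ?e2 + (x1 * y2 - x2 * y1) * ?e3"
      by (simp_all add: algebra_simps)
    then have "?D * u = 0" "?D * v = 0" "?D * w = 0"
      by (simp_all only: e mult_zero_right diff_0_right add_0_right)
    then show ?thesis
      using det by simp
  qed
  then show ?thesis
    using carr unfolding frame_def X' Y' Z' by (simp add: carr_closed)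
qed

text \<open>A vector outside the span would give four independent vectors in a space spanned by
  three.\<close>

lemma frame_span:
  assumes "dim (carr G) = 3" "frame X Y Z" "v \<in> carr G"
  obtains x y z where "v = x \<cdot> X + y \<cdot> Y + z \<cdot> Z"
proof -
  have B: "{X, Y, Z} \<subseteq> carr G" "independent {X, Y, Z}" "card {X, Y, Z} = 3"
    using assms(2) frame_iff_independent[of X Y Z] by simp_all
  obtain S where S: "carr G \<subseteq> span S" "card S = 3"
    using assms(1) by (metis basis_exists[of "carr G"])
  have "finite S"
    using S(2) by (metis card.infinite zero_neq_numeral)
  have "v \<in> span {X, Y, Z}"
  proof (rule ccontr)
    assume v: "v \<notin> span {X, Y, Z}"
    have "independent (insert v {X, Y, Z})"
      using v B(2) by (rule independent_insertI)
    moreover have "insert v {X, Y, Z} \<subseteq> span S"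
      using B(1) S(1) assms(3) by auto
    ultimately have "card (insert v {X, Y, Z}) \<le> card S"
      using independent_span_bound[OF \<open>finite S\<close>] by simp
    moreover have "card (insert v {X, Y, Z}) = Suc (card {X, Y, Z})"
      using v span_base[of v "{X, Y, Z}"] by (intro card_insert_disjoint) auto
    ultimately show False
      unfolding B(3) S(2) by simp
  qed
  then obtain x y z where "v - x \<cdot> X - y \<cdot> Y - z \<cdot> Z = 0"
    by (auto simp: span_breakdown_eq)
  then have "v = x \<cdot> X + y \<cdot> Y + z \<cdot> Z"
    by (simp add: diff_diff_eq)
  then show thesis
    by (rule that)
qed

section \<open>Adapted bases and their normal forms\<close>

text \<open>In dimension 3 this presents the algebra as the semidirect product of the line through X
  with the abelian ideal spanned by Y and Z.\<close>

definition adapted :: "complex \<Rightarrow> complex \<Rightarrow> complex \<Rightarrow> complex \<Rightarrow> 'a \<Rightarrow> 'a \<Rightarrow> 'a \<Rightarrow> bool"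
  where "adapted a b c d X Y Z \<longleftrightarrow> frame X Y Z \<and> brack G X Y = a \<cdot> Y + b \<cdot> Z \<and>
    brack G X Z = c \<cdot> Y + d \<cdot> Z \<and> brack G Y Z = 0"

text \<open>Let A and A' be the matrices with rows (a, b), (c, d) and (a', b'), (c', d'), and let P
  have rows (p, q), (r, u). The equations say sPA = A'P, that is, A' is s times a conjugate of A;
  this form avoids inverting P.\<close>

lemma adapted_change:
  assumes "adapted a b c d X Y Z" "s \<noteq> 0" "p * u - q * r \<noteq> 0"
    and e: "s * (p * a + q * c) = a' * p + b' * r" "s * (p * b + q * d) = a' * q + b' * u"
      "s * (r * a + u * c) = c' * p + d' * r" "s * (r * b + u * d) = c' * q + d' * u"
  shows "adapted a' b' c' d' (s \<cdot> X) (p \<cdot> Y + q \<cdot> Z) (r \<cdot> Y + u \<cdot> Z)"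
proof -
  note A = assms(1)[unfolded adapted_def]
  have carr: "X \<in> carr G" "Y \<in> carr G" "Z \<in> carr G"
    using A by (simp_all add: frame_def)
  have "frame (s \<cdot> X) (p \<cdot> Y + q \<cdot> Z) (r \<cdot> Y + u \<cdot> Z)"
    by (rule frame_change[of X Y Z _ s 0 0 _ 0 p q _ 0 r u]) (use A assms(2,3) in \<open>auto simp: mult.commute\<close>)
  moreover have XY: "brack G (s \<cdot> X) (p \<cdot> Y + q \<cdot> Z) = (s * (p * a + q * c)) \<cdot> Y + (s * (p * b + q * d)) \<cdot> Z" for p q
    using A carr by (simp add: brack_add_right brack_scale_left brack_scale_right carr_closed
        scale_right_distrib scale_left_distrib algebra_simps)
  moreover have "brack G (p \<cdot> Y + q \<cdot> Z) (r \<cdot> Y + u \<cdot> Z) = 0"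
    using brack_lincomb[of X Y Z 0 p q 0 r u] A carr by simp
  ultimately show ?thesis
    unfolding adapted_def XY e
    by (simp add: scale_right_distrib scale_left_distrib algebra_simps)
qed

text \<open>An eigenvector as new Y makes the matrix triangular, with rows (l, 0) and (m, n). Unless
  both eigenvalues vanish, X is divided by one of largest modulus, which produces the eigenvalue 1
  and the bound on \<mu>.\<close>

lemma adapted_normal_form:
  assumes "adapted a b c d X Y Z"
  obtains X' Y' Z' where "adapted 0 0 0 0 X' Y' Z'"
    | X' Y' Z' where "adapted 0 1 0 0 X' Y' Z'"
    | X' Y' Z' where "adapted 1 0 1 1 X' Y' Z'"
    | X' Y' Z' \<mu> where "adapted 1 0 0 \<mu> X' Y' Z'" "cmod \<mu> \<le> 1"
proof -
  obtain l p q where e: "p * a + q * c = l * p" "p * b + q * d = l * q" "p \<noteq> 0 \<or> q \<noteq> 0"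
    by (rule complex_matrix2_eigenvector)
  \<comment> \<open>A unit vector that completes (p, q) to a basis: the determinant is p, or -q if p
    = 0.\<close>
  define r u where "r = (if p = 0 then 1 else 0 :: complex)" and "u = (if p = 0 then 0 else 1 :: complex)"
  have det: "p * u - q * r \<noteq> 0"
    using e(3) by (auto simp: r_def u_def)
  define D where "D = p * u - q * r"
  \<comment> \<open>Cramer's rule for the coordinates, in the new basis, of the image of the second
    basis vector.\<close>
  define m where "m = ((r * a + u * c) * u - (r * b + u * d) * r) / D"
  define n where "n = (p * (r * b + u * d) - q * (r * a + u * c)) / D"
  have D: "D \<noteq> 0"
    using det by (simp add: D_def)
  have "r * a + u * c = m * p + n * r" "r * b + u * d = m * q + n * u"
  proof -
    have "m * D = (r * a + u * c) * u - (r * b + u * d) * r" "n * D = p * (r * b + u * d) - q * (r * a + u * c)"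
      using D by (simp_all add: m_def n_def)
    then have "D * (r * a + u * c) = D * (m * p + n * r)" "D * (r * b + u * d) = D * (m * q + n * u)"
      unfolding D_def by algebra+
    then show "r * a + u * c = m * p + n * r" "r * b + u * d = m * q + n * u"
      using D by simp_all
  qed
  with e det assms obtain X1 Y1 Z1 where 1: "adapted l 0 m n X1 Y1 Z1"
    using adapted_change[of a b c d X Y Z 1 p u q r l 0 m n] by auto
  note change = adapted_change[OF 1]
  \<comment> \<open>The cases are: zero, nilpotent, one Jordan block, scalar, and two distinct
    eigenvalues in either order of modulus.\<close>
  consider "l = 0" "n = 0" "m = 0" | "l = 0" "n = 0" "m \<noteq> 0" | "l = n" "l \<noteq> 0" "m \<noteq> 0"
    | "l = n" "l \<noteq> 0" "m = 0" | "l \<noteq> n" "cmod n \<le> cmod l" | "l \<noteq> n" "cmod l \<le> cmod n"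
    by (cases "l = n"; cases "l = 0"; cases "m = 0") (use linear[of "cmod n" "cmod l"] in auto)
  then show thesis
  proof cases
    case 1
    then show ?thesis
      using \<open>adapted l 0 m n X1 Y1 Z1\<close> that(1) by simp
  next
    case 2
    show ?thesis
      by (rule that(2), rule change[where s = 1 and p = 0 and q = 1 and r = m and u = 0]) (use 2 in auto)
  next
    case 3
    show ?thesis
      by (rule that(3), rule change[where s = "1/l" and p = "m/l" and q = 0 and r = 0 and u = 1]) (use 3 in auto)
  next
    case 4
    show ?thesis
      by (rule that(4)[where \<mu> = 1], rule change[where s = "1/l" and p = 1 and q = 0 and r = 0 and u = 1])
        (use 4 in auto)
  next
    case 5
    then have l: "l \<noteq> 0"
      by auto
    show ?thesis
    proof (rule that(4)[where \<mu> = "n/l"])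
      show "cmod (n/l) \<le> 1"
        using 5 l by (simp add: norm_divide)
    \<comment> \<open>The row (m/(n-l), 1) is an eigenvector for \<open>n\<close>, so the matrix
      becomes diagonal.\<close>
    qed (rule change[where s = "1/l" and p = 1 and q = 0 and r = "m/(n-l)" and u = 1],
        use 5 l in \<open>auto simp: field_simps\<close>)
  next
    case 6
    then have n: "n \<noteq> 0"
      by auto
    show ?thesis
    proof (rule that(4)[where \<mu> = "l/n"])
      show "cmod (l/n) \<le> 1"
        using 6 n by (simp add: norm_divide)
    qed (rule change[where s = "1/n" and r = 1 and u = 0 and p = "m/(n-l)" and q = 1],
        use 6 n in \<open>auto simp: field_simps\<close>)
  qed
qed

section \<open>Existence of an adapted basis\<close>

text \<open>Otherwise the derived series is constant and never reaches zero.\<close>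

lemma solvable_derived_proper:
  assumes "lie_solvable G" "carr G \<noteq> {0}"
  shows "span {brack G x y |x y. x \<in> carr G \<and> y \<in> carr G} \<noteq> carr G"
proof
  assume *: "span {brack G x y |x y. x \<in> carr G \<and> y \<in> carr G} = carr G"
  have "derived_series G n = carr G" for n
    by (induction n) (simp_all add: *)
  then show False
    using assms by (simp add: lie_solvable_def)
qed

text \<open>A basis of the derived algebra, a proper subspace, extends to a basis of the whole
  algebra. With X one of the added vectors, the plane of the other two contains all
  brackets.\<close>

lemma solvable_frame:
  assumes "dim (carr G) = 3" "lie_solvable G"
  obtains X Y Z a b c d e f where "frame X Y Z" "brack G X Y = a \<cdot> Y + b \<cdot> Z"
    "brack G X Z = c \<cdot> Y + d \<cdot> Z" "brack G Y Z = e \<cdot> Y + f \<cdot> Z"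
proof -
  define D where "D = span {brack G x y |x y. x \<in> carr G \<and> y \<in> carr G}"
  have D_carr: "D \<subseteq> carr G"
    unfolding D_def by (rule span_minimal[OF _ subspace_carr]) (auto intro: brack_closed)
  have "carr G \<noteq> {0}"
  proof
    assume "carr G = {0}"
    moreover have "dim {0} = 0"
      using dim_eq_card[of "{}" "{0}"] independent_empty by simp
    ultimately show False
      using assms(1) by simp
  qed
  then have D_ne: "D \<noteq> carr G"
    unfolding D_def by (rule solvable_derived_proper[OF assms(2)])
  obtain B where B: "B \<subseteq> D" "independent B" "D \<subseteq> span B"
    by (rule basis_exists[of D])
  obtain C where C: "B \<subseteq> C" "C \<subseteq> carr G" "independent C" "carr G \<subseteq> span C"
    by (rule maximal_independent_subset_extend[OF order_trans[OF B(1) D_carr] B(2)])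
  have card: "card C = 3"
    using basis_card_eq_dim[OF C(2,4,3)] assms(1) by simp
  have "span B \<subseteq> D"
    using B(1) by (intro span_minimal) (simp_all add: D_def)
  then have "B \<noteq> C"
    using C(4) D_ne D_carr by auto
  then obtain X where X: "X \<in> C" "X \<notin> B"
    using C(1) by auto
  have "card (C - {X}) = 2"
    using card X by simp
  then obtain Y Z where YZ: "C - {X} = {Y, Z}"
    unfolding card_2_iff by blast
  then have C_eq: "C = {X, Y, Z}"
    using X(1) insert_Diff[of X C] by simp
  have frame: "frame X Y Z"
    using C(2,3) card unfolding frame_iff_independent C_eq by simp
  have br: "\<exists>a b. brack G x y = a \<cdot> Y + b \<cdot> Z" if "x \<in> carr G" "y \<in> carr G" for x y
  proof -
    have "brack G x y \<in> D"
      unfolding D_def using that by (intro span_base) blast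
    also have "D \<subseteq> span {Y, Z}"
    proof -
      have "B \<subseteq> {Y, Z}"
        using C(1) X(2) YZ(1) by auto
      then show ?thesis
        using B(3) span_mono by (metis order_trans)
    qed
    finally have "brack G x y \<in> span {Y, Z}" .
    then obtain a b where "brack G x y - a \<cdot> Y - b \<cdot> Z = 0"
      by (auto simp: span_breakdown_eq)
    then show ?thesis
      by (auto simp: diff_diff_eq)
  qed
  have carr: "X \<in> carr G" "Y \<in> carr G" "Z \<in> carr G"
    using frame by (simp_all add: frame_def)
  obtain a b c d e f where "brack G X Y = a \<cdot> Y + b \<cdot> Z"
    "brack G X Z = c \<cdot> Y + d \<cdot> Z" "brack G Y Z = e \<cdot> Y + f \<cdot> Z"
    using br[OF carr(1,2)] br[OF carr(1,3)] br[OF carr(2,3)] by blast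
  with frame show thesis
    by (rule that)
qed

lemma solvable_adapted:
  assumes "dim (carr G) = 3" "lie_solvable G"
  obtains X Y Z a b c d where "adapted a b c d X Y Z"
proof -
  obtain X Y Z a b c d e f where F: "frame X Y Z" and br: "brack G X Y = a \<cdot> Y + b \<cdot> Z"
    "brack G X Z = c \<cdot> Y + d \<cdot> Z" "brack G Y Z = e \<cdot> Y + f \<cdot> Z"
    using solvable_frame assms by metis
  have carr: "X \<in> carr G" "Y \<in> carr G" "Z \<in> carr G"
    using F by (simp_all add: frame_def)
  \<comment> \<open>The Jacobi identity makes (a, b) and (c, d) proportional to (e, f) whenever (e,
    f) is nonzero.\<close>
  have jac: "f * c = d * e" "e * b = a * f"
  proof -
    have "brack G X (brack G Y Z) + brack G Y (brack G Z X) + brack G Z (brack G X Y)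
        = 0 \<cdot> X + (f * c - d * e) \<cdot> Y + (e * b - a * f) \<cdot> Z"
      using carr by (simp add: br brack_skew[of X Z] brack_skew[of Y Z] brack_add_right brack_scale_right 
          scale_minus_left[symmetric] carr_closed brack_self scale_right_distrib
          del: scale_minus_left) (simp add: algebra_simps)
    then have "0 \<cdot> X + (f * c - d * e) \<cdot> Y + (e * b - a * f) \<cdot> Z = 0"
      using jacobi[OF carr] by simp
    then have "f * c - d * e = 0 \<and> e * b - a * f = 0"
      using F unfolding frame_def by blast
    then show "f * c = d * e" "e * b = a * f"
      by simp_all
  qed
  show thesis
  proof (cases "e = 0 \<and> f = 0")
    case True
    then show thesis
      using that[of a b c d X Y Z] F br by (simp add: adapted_def)
  next
    case False
    \<comment> \<open>With these factors ad X agrees on the plane of Y and Z with the inner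
      derivation of \<beta>Y - \<alpha>Z.\<close>
    obtain \<alpha> \<beta> where \<alpha>\<beta>: "a = \<alpha> * e" "b = \<alpha> * f" "c = \<beta> * e" "d = \<beta> * f"
    proof (cases "e = 0")
      case True
      then show thesis
        using that[of "b / f" "d / f"] False jac by (simp add: field_simps)
    next
      case False
      then show thesis
        using that[of "a / e" "c / e"] jac by (simp add: field_simps)
    qed
    \<comment> \<open>This determinant is the factor in [pY + qZ, eY + fZ] = (pf - qe)[Y, Z]; the
      value 1 yields [w, v] = v below.\<close>
    obtain p q where pq: "p * f - q * e = 1"
    proof (cases "e = 0")
      case True
      then show thesis
        using that[of "1 / f" 0] False by simp
    next
      case False
      then show thesis
        using that[of 0 "- (1 / e)"] by simp
    qed
    \<comment> \<open>Here \<open>\<langle>Y, Z\<rangle>\<close> is the nonabelian algebra \<open>[w, v] = v\<close>, all of whose derivations are inner, so that it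
      has a central complement \<open>z\<close>; the abelian ideal is \<open>\<langle>v, z\<rangle>\<close>.\<close>
    let ?w = "0 \<cdot> X + p \<cdot> Y + q \<cdot> Z" and ?v = "0 \<cdot> X + e \<cdot> Y + f \<cdot> Z"
    let ?z = "1 \<cdot> X + (- \<beta>) \<cdot> Y + \<alpha> \<cdot> Z"
    have X: "brack G X Y = \<alpha> \<cdot> ?v" "brack G X Z = \<beta> \<cdot> ?v" "brack G Y Z = ?v"
      by (simp_all add: br \<alpha>\<beta> scale_right_distrib)
    have "frame ?w ?v ?z"
      by (rule frame_change[OF F refl refl refl]) (use pq in \<open>simp add: mult.commute\<close>)
    moreover have "brack G ?w ?v = 1 \<cdot> ?v + 0 \<cdot> ?z"
      unfolding brack_lincomb[OF carr] X using pq by simp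
    moreover have "brack G ?w ?z = 0 \<cdot> ?v + 0 \<cdot> ?z" "brack G ?v ?z = 0"
      unfolding brack_lincomb[OF carr] X by (simp_all only: scale_scale scale_left_distrib[symmetric]) simp_all
    ultimately show thesis
      using that unfolding adapted_def by blast
  qed
qed

end

lemma dual_linear:
  assumes "f \<in> dual G" "x \<in> carr G"
  shows "y \<in> carr G \<Longrightarrow> f (x + y) = f x + f y" "f (scal G c x) = c * f x"
  using assms by (simp_all add: dual_def linear_on_def)

section \<open>A criterion for decomposability\<close>

text \<open>A central non-isotropic \<open>v\<close> splits off: the two ideals are the span of \<open>v\<close> and its complement.\<close>

lemma ext_model_not_indecomposable:
  assumes "vector_space (scal Q)" "module.subspace (scal Q) (carr Q)"
    and closed: "\<And>x y. x \<in> carr Q \<Longrightarrow> y \<in> carr Q \<Longrightarrow> brack Q x y \<in> carr Q"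
    and iso: "i_isomorphic Q M" and M: "M = ext_model a b c d t"
    and central: "\<And>x. brack M x v = 0" and vv: "form M v v \<noteq> 0"
    and orth: "\<And>x y. form M v (brack M x y) = 0"
    and w: "w \<noteq> 0" "form M v w = 0"
  shows "\<not> indecomposable Q"
proof
  assume indec: "indecomposable Q"
  interpret vector_space "scal Q"
    by (rule assms(1))
  obtain \<phi> where bij: "bij_betw \<phi> (carr Q) UNIV" and lin: "linear_on (carr Q) (scal Q) (*s) \<phi>"
    and br: "\<And>x y. x \<in> carr Q \<Longrightarrow> y \<in> carr Q \<Longrightarrow> \<phi> (brack Q x y) = brack M (\<phi> x) (\<phi> y)"
    and form: "\<And>x y. x \<in> carr Q \<Longrightarrow> y \<in> carr Q \<Longrightarrow> form M (\<phi> x) (\<phi> y) = form Q x y"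
    using iso unfolding i_isomorphic_def M ext_model_simps(1,2) by blast
  have zero: "0 \<in> carr Q" and add: "\<And>x y. x \<in> carr Q \<Longrightarrow> y \<in> carr Q \<Longrightarrow> x + y \<in> carr Q"
    and scale: "\<And>c x. x \<in> carr Q \<Longrightarrow> scal Q c x \<in> carr Q"
    using assms(2) by (auto simp: subspace_def)
  have \<phi>_add: "\<phi> (x + y) = \<phi> x + \<phi> y" if "x \<in> carr Q" "y \<in> carr Q" for x y
    using lin that by (simp add: linear_on_def)
  have \<phi>_scale: "\<phi> (scal Q c x) = c *s \<phi> x" if "x \<in> carr Q" for c x
    using lin that by (simp add: linear_on_def)
  have \<phi>_0: "\<phi> 0 = 0"
    using \<phi>_scale[OF zero, of 0] by simp
  have inj: "x = y" if "\<phi> x = \<phi> y" "x \<in> carr Q" "y \<in> carr Q" for x y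
    using bij that by (meson bij_betw_def inj_onD)
  have surj: "\<exists>x\<in>carr Q. \<phi> x = u" for u
    using bij by (metis UNIV_I bij_betw_def imageE)
  have form_add: "form M x (y + z) = form M x y + form M x z"
    and form_scale: "form M x (k *s y) = k * form M x y" and form_sym: "form M x y = form M y x" for x y z k
    by (simp_all add: M algebra_simps)
  have brack_scale: "brack M x (k *s y) = k *s brack M x y" for x y k
    by (simp add: M vec_eq_iff forall_basis6 algebra_simps)
  define I where "I = {x \<in> carr Q. \<exists>k. \<phi> x = k *s v}"
  define J where "J = {x \<in> carr Q. form M v (\<phi> x) = 0}"
  have "lie_ideal Q I"
    unfolding lie_ideal_def
  proof (intro conjI ballI)
    show "subspace I"
      unfolding subspace_def I_def
    proof (intro conjI ballI allI; clarify)
      show "0 \<in> carr Q \<and> (\<exists>k. \<phi> 0 = k *s v)"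
        using \<phi>_0 zero by (metis vector_smult_lzero)
    next
      fix x y k l assume "x \<in> carr Q" "y \<in> carr Q" "\<phi> x = k *s v" "\<phi> y = l *s v"
      then show "x + y \<in> carr Q \<and> (\<exists>k. \<phi> (x + y) = k *s v)"
        by (metis add \<phi>_add vector_sadd_rdistrib)
    next
      fix c x k assume "x \<in> carr Q" "\<phi> x = k *s v"
      then show "scal Q c x \<in> carr Q \<and> (\<exists>k. \<phi> (scal Q c x) = k *s v)"
        by (metis scale \<phi>_scale vector_smult_assoc)
    qed
    fix x y assume xy: "x \<in> carr Q" "y \<in> I"
    then obtain k where k: "y \<in> carr Q" "\<phi> y = k *s v"
      by (auto simp: I_def)
    have "\<phi> (brack Q x y) = 0 *s v"
      unfolding br[OF xy(1) k(1)] k(2) brack_scale central by simp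
    then show "brack Q x y \<in> I"
      using closed[OF xy(1) k(1)] unfolding I_def by blast
  qed (auto simp: I_def)
  moreover have "lie_ideal Q J"
    unfolding lie_ideal_def
  proof (intro conjI ballI)
    have "form M v 0 = 0"
      by (simp add: M)
    then show "subspace J"
      unfolding subspace_def J_def
      by (auto simp: zero add scale \<phi>_0 \<phi>_add \<phi>_scale form_add form_scale)
  qed (auto simp: J_def br orth closed)
  moreover have "{x + y |x y. x \<in> I \<and> y \<in> J} = carr Q"
  proof
    show "{x + y |x y. x \<in> I \<and> y \<in> J} \<subseteq> carr Q"
      by (auto simp: I_def J_def add)
    show "carr Q \<subseteq> {x + y |x y. x \<in> I \<and> y \<in> J}"
    proof
      fix x assume x: "x \<in> carr Q"
      \<comment> \<open>The coefficient of the orthogonal projection of \<open>\<phi> x\<close> onto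
        the line of \<open>v\<close>.\<close>
      define k where "k = form M v (\<phi> x) / form M v v"
      obtain i where i: "i \<in> carr Q" "\<phi> i = k *s v"
        using surj by blast
      obtain j where j: "j \<in> carr Q" "\<phi> j = \<phi> x + (- k) *s v"
        using surj by blast
      have "form M v (\<phi> j) = 0"
        unfolding j(2) form_add form_scale using vv by (simp add: k_def)
      moreover have "x = i + j"
        by (rule inj) (use i j x in \<open>simp_all add: \<phi>_add add\<close>)
      ultimately show "x \<in> {x + y |x y. x \<in> I \<and> y \<in> J}"
        using i j(1) unfolding I_def J_def by blast
    qed
  qed
  moreover have "I \<inter> J = {0}"
  proof
    show "I \<inter> J \<subseteq> {0}"
    proof
      fix x assume "x \<in> I \<inter> J"
      then have x: "x \<in> carr Q" "form M v (\<phi> x) = 0" and "\<exists>k. \<phi> x = k *s v"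
        unfolding I_def J_def by simp_all
      then obtain k where k: "\<phi> x = k *s v"
        by (elim exE)
      have "k = 0"
        using x(2) vv unfolding k form_scale by simp
      then have "\<phi> x = \<phi> 0"
        by (simp add: k \<phi>_0)
      then have "x = 0"
        using x(1) zero by (rule inj)
      then show "x \<in> {0}"
        by simp
    qed
    show "{0} \<subseteq> I \<inter> J"
      using subspace_0[of I] subspace_0[of J] \<open>lie_ideal Q I\<close> \<open>lie_ideal Q J\<close>
      unfolding lie_ideal_def by blast
  qed
  moreover have "form Q x y = 0" if xy: "x \<in> I" "y \<in> J" for x y
  proof -
    obtain k where k: "x \<in> carr Q" "\<phi> x = k *s v"
      using xy(1) by (auto simp: I_def)
    have "form Q x y = form M (k *s v) (\<phi> y)"
      using form[OF k(1), of y] xy(2) unfolding J_def k(2) by simp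
    also have "\<dots> = k * form M v (\<phi> y)"
      by (simp only: form_sym[of _ "\<phi> y"] form_scale)
    also have "\<dots> = 0"
      using xy(2) by (simp add: J_def)
    finally show ?thesis .
  qed
  ultimately have "I = {0} \<or> J = {0}"
    using indec[unfolded indecomposable_def, rule_format, of I J] by simp
  moreover have "I \<noteq> {0}"
  proof -
    obtain x where x: "x \<in> carr Q" "\<phi> x = 1 *s v"
      using surj by blast
    then have "x \<in> I"
      unfolding I_def by blast
    moreover have "x \<noteq> 0"
      using x(2) vv \<phi>_0 by (auto simp: M)
    ultimately show ?thesis
      by blast
  qed
  moreover have "J \<noteq> {0}"
  proof -
    obtain x where x: "x \<in> carr Q" "\<phi> x = w"
      using surj by blast
    then have "x \<in> J"
      using w(2) unfolding J_def by simp
    moreover have "x \<noteq> 0"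
      using x(2) w(1) \<phi>_0 by auto
    ultimately show ?thesis
      by blast
  qed
  ultimately show False
    by blast
qed

section \<open>The extension in coordinates\<close>

context lie_algebra
begin

text \<open>The coordinates are chosen vector by vector; their linearity comes from the uniqueness
  in \<open>frame_eq_iff\<close>. Nothing is said about their values outside the carrier.\<close>

lemma frame_coordinates:
  assumes "dim (carr G) = 3" "frame X Y Z"
  obtains x y z where "\<And>v. v \<in> carr G \<Longrightarrow> v = x v \<cdot> X + y v \<cdot> Y + z v \<cdot> Z"
    "\<And>a b c. x (a \<cdot> X + b \<cdot> Y + c \<cdot> Z) = a" "\<And>a b c. y (a \<cdot> X + b \<cdot> Y + c \<cdot> Z) = b"
    "\<And>a b c. z (a \<cdot> X + b \<cdot> Y + c \<cdot> Z) = c"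
    "linear_on (carr G) (scal G) (*) x" "linear_on (carr G) (scal G) (*) y"
    "linear_on (carr G) (scal G) (*) z"
proof -
  have XYZ: "X \<in> carr G" "Y \<in> carr G" "Z \<in> carr G"
    using assms(2) by (simp_all add: frame_def)
  have "\<exists>p. v = fst p \<cdot> X + fst (snd p) \<cdot> Y + snd (snd p) \<cdot> Z" if "v \<in> carr G" for v
    using frame_span[OF assms that] by (metis fst_conv snd_conv)
  then obtain p where p: "\<And>v. v \<in> carr G \<Longrightarrow> v = fst (p v) \<cdot> X + fst (snd (p v)) \<cdot> Y + snd (snd (p v)) \<cdot> Z"
    by metis
  define x y z where "x v = fst (p v)" and "y v = fst (snd (p v))" and "z v = snd (snd (p v))" for v
  have v: "v = x v \<cdot> X + y v \<cdot> Y + z v \<cdot> Z" if "v \<in> carr G" for v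
    unfolding x_def y_def z_def by (rule p[OF that])
  have xyz: "x (a \<cdot> X + b \<cdot> Y + c \<cdot> Z) = a \<and> y (a \<cdot> X + b \<cdot> Y + c \<cdot> Z) = b \<and>
      z (a \<cdot> X + b \<cdot> Y + c \<cdot> Z) = c" for a b c
    using v[OF lincomb_closed[OF XYZ, of a b c]] frame_eq_iff[OF assms(2)] by metis
  have add: "x (u + v) = x u + x v \<and> y (u + v) = y u + y v \<and> z (u + v) = z u + z v"
    if "u \<in> carr G" "v \<in> carr G" for u v
  proof -
    have "u + v = (x u \<cdot> X + y u \<cdot> Y + z u \<cdot> Z) + (x v \<cdot> X + y v \<cdot> Y + z v \<cdot> Z)"
      using v[OF that(1)] v[OF that(2)] by (rule arg_cong2[where f = "(+)"])
    also have "\<dots> = (x u + x v) \<cdot> X + (y u + y v) \<cdot> Y + (z u + z v) \<cdot> Z"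
      by (simp add: scale_left_distrib add_ac)
    finally show ?thesis
      using xyz by simp
  qed
  have scale: "x (c \<cdot> v) = c * x v \<and> y (c \<cdot> v) = c * y v \<and> z (c \<cdot> v) = c * z v"
    if "v \<in> carr G" for c v
  proof -
    have "c \<cdot> v = c \<cdot> (x v \<cdot> X + y v \<cdot> Y + z v \<cdot> Z)"
      using v[OF that] by (rule arg_cong[where f = "smul c"])
    also have "\<dots> = (c * x v) \<cdot> X + (c * y v) \<cdot> Y + (c * z v) \<cdot> Z"
      by (simp add: scale_right_distrib)
    finally show ?thesis
      using xyz by simp
  qed
  show thesis
    by (rule that[OF v]) (use xyz add scale in \<open>auto simp: linear_on_def\<close>)
qed

lemma dual_lincomb:
  assumes "f \<in> dual G" "X \<in> carr G" "Y \<in> carr G" "Z \<in> carr G"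
  shows "f (x \<cdot> X + y \<cdot> Y + z \<cdot> Z) = x * f X + y * f Y + z * f Z"
  using assms by (simp add: dual_linear carr_closed)

lemma coad_dual:
  assumes "x \<in> carr G" "f \<in> dual G"
  shows "coad G x f \<in> dual G"
  using assms
  by (simp add: dual_def[of G] coad_def linear_on_def carr_closed brack_add_right brack_scale_right
      dual_linear[OF assms(2)])

lemma dual_closed:
  "0 \<in> dual G" "f \<in> dual G \<Longrightarrow> g \<in> dual G \<Longrightarrow> f + g \<in> dual G"
  "f \<in> dual G \<Longrightarrow> g \<in> dual G \<Longrightarrow> f - g \<in> dual G"
  "f \<in> dual G \<Longrightarrow> dual_smult c f \<in> dual G"
  by (simp_all add: dual_def linear_on_def dual_smult_def algebra_simps)

lemma adapted_brack:
  assumes "adapted a b c d X Y Z"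
  shows "brack G (x \<cdot> X + y \<cdot> Y + z \<cdot> Z) (x' \<cdot> X + y' \<cdot> Y + z' \<cdot> Z) =
    0 \<cdot> X + (a * (x * y' - y * x') + c * (x * z' - z * x')) \<cdot> Y
          + (b * (x * y' - y * x') + d * (x * z' - z * x')) \<cdot> Z"
proof -
  have "X \<in> carr G" "Y \<in> carr G" "Z \<in> carr G"
    using assms by (simp_all add: adapted_def frame_def)
  from brack_lincomb[OF this] show ?thesis
    using assms by (simp add: adapted_def scale_right_distrib scale_left_distrib add_ac mult.commute)
qed

lemma T_star_simps:
  "scal (T_star G \<theta>) c (x, f) = (c \<cdot> x, dual_smult c f)"
  "carr (T_star G \<theta>) = carr G \<times> dual G"
  "brack (T_star G \<theta>) (x, f) (y, g) = (brack G x y, coad G x g - coad G y f + \<theta> x y)"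
  "form (T_star G \<theta>) (x, f) (y, g) = f y + g x"
  by (simp_all add: T_star_def)

lemma T_star_vector_space: "vector_space (scal (T_star G \<theta>))"
  by unfold_locales
    (auto simp: T_star_simps dual_smult_def fun_eq_iff scale_right_distrib scale_left_distrib algebra_simps)

lemma T_star_subspace: "module.subspace (scal (T_star G \<theta>)) (carr (T_star G \<theta>))"
proof -
  interpret T: vector_space "scal (T_star G \<theta>)"
    by (rule T_star_vector_space)
  show ?thesis
    unfolding T.subspace_def by (auto simp: T_star_simps carr_closed dual_closed zero_prod_def)
qed

context
  fixes \<theta> :: "'a \<Rightarrow> 'a \<Rightarrow> 'a \<Rightarrow> complex"
  assumes cyclic: "cyclic_two_cocycle G \<theta>"
begin

lemma cocycle_dual: "x \<in> carr G \<Longrightarrow> y \<in> carr G \<Longrightarrow> \<theta> x y \<in> dual G"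
  using cyclic[unfolded cyclic_two_cocycle_def two_cocycle_def, THEN conjunct1, THEN conjunct1]
  by blast

lemma cocycle_skew:
  assumes "x \<in> carr G" "y \<in> carr G"
  shows "\<theta> y x z = - \<theta> x y z"
proof -
  have "\<forall>x\<in>carr G. \<forall>y\<in>carr G. \<theta> x y = - \<theta> y x"
    using cyclic unfolding cyclic_two_cocycle_def two_cocycle_def by (elim conjE)
  from this[rule_format, OF assms(2,1)] have "\<theta> y x = - \<theta> x y" .
  then show ?thesis
    by simp
qed

lemma cocycle_cyclic: "x \<in> carr G \<Longrightarrow> y \<in> carr G \<Longrightarrow> z \<in> carr G \<Longrightarrow> \<theta> x y z = \<theta> y z x"
  using cyclic[unfolded cyclic_two_cocycle_def, THEN conjunct2, rule_format] .

text \<open>Skew-symmetry settles equal first arguments, and cyclicity carries this to the other two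
  pairs. Thus \<theta>(x, y)z is an alternating 3-form.\<close>

lemma cocycle_alternating:
  assumes "x \<in> carr G" "y \<in> carr G"
  shows "\<theta> x x y = 0" "\<theta> x y x = 0" "\<theta> y x x = 0"
proof -
  show "\<theta> x x y = 0"
  proof -
    have "\<theta> x x y + \<theta> x x y = 0"
      using cocycle_skew[OF assms(1,1)] by (simp only: eq_neg_iff_add_eq_0)
    then show ?thesis
      by simp
  qed
  then show "\<theta> x y x = 0" "\<theta> y x x = 0"
    using cocycle_cyclic[of x x y] cocycle_cyclic[of x y x] assms by simp_all
qed

lemma cocycle_linear:
  assumes "x \<in> carr G" "y \<in> carr G"
  shows "z \<in> carr G \<Longrightarrow> \<theta> (x + z) y w = \<theta> x y w + \<theta> z y w"
    "z \<in> carr G \<Longrightarrow> \<theta> y (x + z) w = \<theta> y x w + \<theta> y z w"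
    "\<theta> (c \<cdot> x) y w = c * \<theta> x y w" "\<theta> y (c \<cdot> x) w = c * \<theta> y x w"
proof -
  have "bilinear_on (carr G) (scal G) dual_smult \<theta>"
    using cyclic unfolding cyclic_two_cocycle_def two_cocycle_def by (elim conjE)
  then show "z \<in> carr G \<Longrightarrow> \<theta> (x + z) y w = \<theta> x y w + \<theta> z y w"
    "z \<in> carr G \<Longrightarrow> \<theta> y (x + z) w = \<theta> y x w + \<theta> y z w"
    "\<theta> (c \<cdot> x) y w = c * \<theta> x y w" "\<theta> y (c \<cdot> x) w = c * \<theta> y x w"
    using assms by (simp_all add: bilinear_on_def linear_on_def dual_smult_def)
qed

text \<open>On the span of X, Y, Z an alternating 3-form is a multiple of the determinant; the
  right-hand sides are its cofactors for a basis vector in the third place.\<close>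

lemma cocycle_lincomb:
  assumes "X \<in> carr G" "Y \<in> carr G" "Z \<in> carr G"
  shows "\<theta> (x \<cdot> X + y \<cdot> Y + z \<cdot> Z) (x' \<cdot> X + y' \<cdot> Y + z' \<cdot> Z) X = \<theta> X Y Z * (y * z' - z * y')"
    "\<theta> (x \<cdot> X + y \<cdot> Y + z \<cdot> Z) (x' \<cdot> X + y' \<cdot> Y + z' \<cdot> Z) Y = - \<theta> X Y Z * (x * z' - z * x')"
    "\<theta> (x \<cdot> X + y \<cdot> Y + z \<cdot> Z) (x' \<cdot> X + y' \<cdot> Y + z' \<cdot> Z) Z = \<theta> X Y Z * (x * y' - y * x')"
proof -
  have c: "\<theta> Y Z X = \<theta> X Y Z" "\<theta> Z X Y = \<theta> X Y Z" "\<theta> Z Y X = - \<theta> X Y Z" "\<theta> X Z Y = - \<theta> X Y Z"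
    "\<theta> Y X Z = - \<theta> X Y Z"
    using cocycle_cyclic[OF assms] cocycle_cyclic[OF assms(2,3,1)] cocycle_skew[OF assms(1,2), of Z]
      cocycle_skew[OF assms(2,3), of X] cocycle_skew[OF assms(3,1), of Y] by simp_all
  show "\<theta> (x \<cdot> X + y \<cdot> Y + z \<cdot> Z) (x' \<cdot> X + y' \<cdot> Y + z' \<cdot> Z) X = \<theta> X Y Z * (y * z' - z * y')"
    "\<theta> (x \<cdot> X + y \<cdot> Y + z \<cdot> Z) (x' \<cdot> X + y' \<cdot> Y + z' \<cdot> Z) Y = - \<theta> X Y Z * (x * z' - z * x')"
    "\<theta> (x \<cdot> X + y \<cdot> Y + z \<cdot> Z) (x' \<cdot> X + y' \<cdot> Y + z' \<cdot> Z) Z = \<theta> X Y Z * (x * y' - y * x')"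
    using assms by (simp_all add: cocycle_linear carr_closed cocycle_alternating c) (simp_all add: algebra_simps)
qed

lemma T_star_brack_closed:
  assumes "p \<in> carr (T_star G \<theta>)" "q \<in> carr (T_star G \<theta>)"
  shows "brack (T_star G \<theta>) p q \<in> carr (T_star G \<theta>)"
  using assms by (cases p; cases q) (simp add: T_star_simps brack_closed coad_dual cocycle_dual dual_closed)

text \<open>The isomorphism sends (u, f) to the coordinates of u followed by the values of f on X,
  Y, Z, which are the coordinates of f in the dual basis.\<close>

lemma T_star_iso_ext_model:
  assumes dim: "dim (carr G) = 3" and A: "adapted a b c d X Y Z"
  shows "i_isomorphic (T_star G \<theta>) (ext_model a b c d (\<theta> X Y Z))"
proof -
  have F: "frame X Y Z"
    using A by (simp add: adapted_def)
  then have XYZ: "X \<in> carr G" "Y \<in> carr G" "Z \<in> carr G"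
    by (simp_all add: frame_def)
  obtain x y z where v: "\<And>v. v \<in> carr G \<Longrightarrow> v = x v \<cdot> X + y v \<cdot> Y + z v \<cdot> Z"
    and xyz: "\<And>a b c. x (a \<cdot> X + b \<cdot> Y + c \<cdot> Z) = a" "\<And>a b c. y (a \<cdot> X + b \<cdot> Y + c \<cdot> Z) = b"
    "\<And>a b c. z (a \<cdot> X + b \<cdot> Y + c \<cdot> Z) = c"
    and lin: "linear_on (carr G) (scal G) (*) x" "linear_on (carr G) (scal G) (*) y"
    "linear_on (carr G) (scal G) (*) z"
    using frame_coordinates[OF dim F] by blast
  have f_eq: "f u = x u * f X + y u * f Y + z u * f Z" if "f \<in> dual G" "u \<in> carr G" for f u
    using dual_lincomb[OF that(1) XYZ] v[OF that(2)] by metis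
  define \<phi> where "\<phi> p = vec6 (x (fst p)) (y (fst p)) (z (fst p)) (snd p X) (snd p Y) (snd p Z)"
    for p :: "'a \<times> ('a \<Rightarrow> complex)"
  have \<phi>: "\<phi> (u, f) = vec6 (x u) (y u) (z u) (f X) (f Y) (f Z)" for u f
    by (simp add: \<phi>_def)
  show ?thesis
    unfolding i_isomorphic_def
  proof (intro exI[of _ \<phi>] conjI ballI)
    have "inj_on \<phi> (carr G \<times> dual G)"
    proof (rule inj_onI, clarify)
      fix u f u' f'
      assume mem: "u \<in> carr G" "f \<in> dual G" "u' \<in> carr G" "f' \<in> dual G" and eq: "\<phi> (u, f) = \<phi> (u', f')"
      have e: "x u = x u'" "y u = y u'" "z u = z u'" "f X = f' X" "f Y = f' Y" "f Z = f' Z"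
        using eq by (auto simp: \<phi> vec_eq_iff forall_basis6)
      have "u = u'"
        using v[OF mem(1)] v[OF mem(3)] e by metis
      moreover have "f w = f' w" for w
      proof (cases "w \<in> carr G")
        case True
        then show ?thesis
          using f_eq[OF mem(2) True] f_eq[OF mem(4) True] e by simp
      next
        case False
        then show ?thesis
          using mem(2,4) by (simp add: dual_def)
      qed
      ultimately show "u = u' \<and> f = f'"
        by auto
    qed
    moreover have "w \<in> \<phi> ` (carr G \<times> dual G)" for w
    proof
      \<comment> \<open>The cutoff puts \<open>f\<close> into \<open>dual G\<close>, since the
        coordinate functions need not vanish outside the carrier.\<close>
      define f where "f u = (if u \<in> carr G then w $ bXs * x u + w $ bYs * y u + w $ bZs * z u else 0)" for u
      define u where "u = w $ bX \<cdot> X + w $ bY \<cdot> Y + w $ bZ \<cdot> Z"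
      have "x X = 1" "x Y = 0" "x Z = 0" "y X = 0" "y Y = 1" "y Z = 0" "z X = 0" "z Y = 0" "z Z = 1"
        using xyz[of 1 0 0] xyz[of 0 1 0] xyz[of 0 0 1] by simp_all
      then have "f X = w $ bXs" "f Y = w $ bYs" "f Z = w $ bZs"
        using XYZ by (simp_all add: f_def)
      then show "w = \<phi> (u, f)"
        by (simp add: \<phi> u_def xyz vec_eq_iff forall_basis6)
      have "f \<in> dual G"
        using lin by (simp add: dual_def linear_on_def f_def carr_closed algebra_simps)
      then show "(u, f) \<in> carr G \<times> dual G"
        using XYZ by (simp add: u_def carr_closed)
    qed
    ultimately show "bij_betw \<phi> (carr (T_star G \<theta>)) (carr (ext_model a b c d (\<theta> X Y Z)))"
      by (auto simp: bij_betw_def T_star_simps)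
    show "linear_on (carr (T_star G \<theta>)) (scal (T_star G \<theta>)) (scal (ext_model a b c d (\<theta> X Y Z))) \<phi>"
      using lin
      by (auto simp: linear_on_def T_star_simps \<phi> dual_smult_def vec_eq_iff forall_basis6)
  next
    fix p q assume pq: "p \<in> carr (T_star G \<theta>)" "q \<in> carr (T_star G \<theta>)"
    obtain u f u' f' where [simp]: "p = (u, f)" "q = (u', f')"
      by (cases p; cases q)
    have mem: "u \<in> carr G" "f \<in> dual G" "u' \<in> carr G" "f' \<in> dual G"
      using pq by (simp_all add: T_star_simps)
    show "form (ext_model a b c d (\<theta> X Y Z)) (\<phi> p) (\<phi> q) = form (T_star G \<theta>) p q"
      using f_eq[OF mem(2,3)] f_eq[OF mem(4,1)] by (simp add: T_star_simps \<phi> algebra_simps)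
    \<comment> \<open>Separate names keep \<open>u\<close> and \<open>u'\<close> out of the
      right-hand sides of their expansions, so that unfolding these terminates.\<close>
    define u1 u2 u3 v1 v2 v3 where uv: "u1 = x u" "u2 = y u" "u3 = z u" "v1 = x u'" "v2 = y u'" "v3 = z u'"
    have u: "u = u1 \<cdot> X + u2 \<cdot> Y + u3 \<cdot> Z" and u': "u' = v1 \<cdot> X + v2 \<cdot> Y + v3 \<cdot> Z"
      unfolding uv using mem by (auto intro: v)
    \<comment> \<open>The zero coefficient of X is written out so that \<open>dual_lincomb\<close>
      matches when a linear form is applied.\<close>
    have ad: "brack G (r1 \<cdot> X + r2 \<cdot> Y + r3 \<cdot> Z) X = 0 \<cdot> X + (- (a * r2 + c * r3)) \<cdot> Y + (- (b * r2 + d * r3)) \<cdot> Z"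
      "brack G (r1 \<cdot> X + r2 \<cdot> Y + r3 \<cdot> Z) Y = 0 \<cdot> X + (a * r1) \<cdot> Y + (b * r1) \<cdot> Z"
      "brack G (r1 \<cdot> X + r2 \<cdot> Y + r3 \<cdot> Z) Z = 0 \<cdot> X + (c * r1) \<cdot> Y + (d * r1) \<cdot> Z" for r1 r2 r3
      using adapted_brack[OF A, of r1 r2 r3 1 0 0] adapted_brack[OF A, of r1 r2 r3 0 1 0]
        adapted_brack[OF A, of r1 r2 r3 0 0 1]
      by (simp_all add: algebra_simps)
    note dl = dual_lincomb[OF mem(2) XYZ] dual_lincomb[OF mem(4) XYZ]
    have coad: "coad G u f' X = (a * u2 + c * u3) * f' Y + (b * u2 + d * u3) * f' Z"
      "coad G u f' Y = - (a * u1 * f' Y + b * u1 * f' Z)" "coad G u f' Z = - (c * u1 * f' Y + d * u1 * f' Z)"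
      "coad G u' f X = (a * v2 + c * v3) * f Y + (b * v2 + d * v3) * f Z"
      "coad G u' f Y = - (a * v1 * f Y + b * v1 * f Z)" "coad G u' f Z = - (c * v1 * f Y + d * v1 * f Z)"
      unfolding coad_def u u' ad dl using XYZ by (simp_all add: algebra_simps)
    have theta: "\<theta> u u' X = \<theta> X Y Z * (u2 * v3 - u3 * v2)" "\<theta> u u' Y = - \<theta> X Y Z * (u1 * v3 - u3 * v1)"
      "\<theta> u u' Z = \<theta> X Y Z * (u1 * v2 - u2 * v1)"
      unfolding u u' by (rule cocycle_lincomb[OF XYZ])+
    have br: "x (brack G u u') = 0" "y (brack G u u') = a * (u1 * v2 - u2 * v1) + c * (u1 * v3 - u3 * v1)"
      "z (brack G u u') = b * (u1 * v2 - u2 * v1) + d * (u1 * v3 - u3 * v1)"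
      unfolding u u' adapted_brack[OF A] by (rule xyz)+
    show "\<phi> (brack (T_star G \<theta>) p q) = brack (ext_model a b c d (\<theta> X Y Z)) (\<phi> p) (\<phi> q)"
      by (simp add: T_star_simps \<phi> vec_eq_iff forall_basis6 br coad theta flip: uv)
        (simp add: algebra_simps)
  qed
qed

end

end

section \<open>Matching the normal forms with the listed algebras\<close>

theorem proposition2p17:
  fixes G :: "('a::ab_group_add, 'm) lie_alg_scheme"
    and \<theta> :: "'a \<Rightarrow> 'a \<Rightarrow> 'a \<Rightarrow> complex"
  assumes "lie_algebra G"
    and "vector_space.dim (scal G) (carr G) = 3"
    and "lie_solvable G"
    and "cyclic_two_cocycle G \<theta>"
    and "indecomposable (T_star G \<theta>)"
  shows "i_isomorphic (T_star G \<theta>) g61 \<or>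
         i_isomorphic (T_star G \<theta>) g62 \<or>
         (\<exists>\<mu>. cmod \<mu> \<le> 1 \<and> \<mu> \<noteq> -1 \<and> i_isomorphic (T_star G \<theta>) (g63 \<mu>))"
proof -
  interpret lie_algebra G
    by (rule assms(1))
  note iso = T_star_iso_ext_model[OF assms(4) assms(2)]
  note decomp = ext_model_not_indecomposable[OF T_star_vector_space T_star_subspace
      T_star_brack_closed[OF assms(4)] _ refl]
  obtain X0 Y0 Z0 a b c d where "adapted a b c d X0 Y0 Z0"
    using solvable_adapted assms(2,3) by metis
  then consider X Y Z where "adapted 0 0 0 0 X Y Z"
    | X Y Z where "adapted 0 1 0 0 X Y Z"
    | X Y Z where "adapted 1 0 1 1 X Y Z"
    | X Y Z \<mu> where "adapted 1 0 0 \<mu> X Y Z" "cmod \<mu> \<le> 1"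
    by (rule adapted_normal_form)
  then show ?thesis
  proof cases
    case 1
    have "\<theta> X Y Z \<noteq> 0"
    proof
      assume "\<theta> X Y Z = 0"
      with iso[OF 1] have i: "i_isomorphic (T_star G \<theta>) (ext_model 0 0 0 0 0)"
        by simp
      \<comment> \<open>All brackets vanish, so every vector is central; X + X^* has square 2 and is
        orthogonal to Y.\<close>
      have "\<not> indecomposable (T_star G \<theta>)"
        by (rule decomp[OF _ _ i, where v = "vec6 1 0 0 1 0 0" and w = "vec6 0 1 0 0 0 0"])
          (simp_all add: vec_eq_iff forall_basis6)
      then show False
        using assms(5) by simp
    qed
    then show ?thesis
      using i_isomorphic_trans[OF iso[OF 1] ext_model_abelian_iso_g61] by simp
  next
    case 2
    have "\<theta> X Y Z = 0"
    proof (rule ccontr)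
      assume t: "\<theta> X Y Z \<noteq> 0"
      \<comment> \<open>Here [X, Z] = t[X, Z^*] and [Y, Z] = t[Y, Z^*] with t =
        \<open>\<theta> X Y Z\<close>, so Z - tZ^* is central; its square is -2t, and X is
        orthogonal to it.\<close>
      have "\<not> indecomposable (T_star G \<theta>)"
        by (rule decomp[OF _ _ iso[OF 2], where v = "vec6 0 0 1 0 0 (- \<theta> X Y Z)" and w = "vec6 1 0 0 0 0 0"])
          (use t in \<open>simp_all add: vec_eq_iff forall_basis6\<close>)
      then show False
        using assms(5) by simp
    qed
    then show ?thesis
      using iso[OF 2] by (simp add: g61_eq)
  next
    case 3
    then show ?thesis
      using i_isomorphic_trans[OF iso[OF 3] ext_model_kill_cocycle] by (simp add: g62_eq)
  next
    case 4
    \<comment> \<open>The trace is 1 + \<mu>, so the cocycle can be removed unless \<mu> =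
      -1.\<close>
    consider "\<mu> \<noteq> -1" | "\<mu> = -1" "\<theta> X Y Z = 0" | "\<mu> = -1" "\<theta> X Y Z \<noteq> 0"
      by blast
    then show ?thesis
    proof cases
      case 1
      then have "1 + \<mu> \<noteq> 0"
        by (metis add_eq_0_iff)
      then have "i_isomorphic (T_star G \<theta>) (g63 \<mu>)"
        unfolding g63_eq by (rule i_isomorphic_trans[OF iso[OF 4(1)] ext_model_kill_cocycle])
      then show ?thesis
        using 1 4(2) by blast
    next
      case 2
      then have "i_isomorphic (T_star G \<theta>) (g63 1)"
        using i_isomorphic_trans[OF iso[OF 4(1)]] ext_model_unimodular_iso_g63 by metis
      then show ?thesis
        by (intro disjI2 exI[of _ 1]) simp
    next
      case 3
      then have "i_isomorphic (T_star G \<theta>) g62"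
        using i_isomorphic_trans[OF iso[OF 4(1)]] ext_model_unimodular_iso_g62 by metis
      then show ?thesis
        by simp
    qed
  qed
qed

end
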